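(* Let $a<b$ be real numbers and let $r,s$ be positive continuous functions on the interval $(a,b)$. Put $R(a,x)=\int_a^x r(t)\,dt$. Then for all measurable functions $f\ge 0$ on $(a,b)$ such that all integrals below exist and are finite, $$\int_a^b r(x)\left(\int_x^b f(t)\,dt\right)^2dx\le \sup_{a<x<b}R(a,x)\,\left(\int_a^b\frac{dx}{s(x)}\right)\int_a^b s(x)\,(f(x))^2\,dx.$$
   Context: Standing assumption: all functions are measurable and all the integrals appearing in the inequality (including those defining $R(a,x)$ and $\int_x^b f$ for $x\in(a,b)$) exist and are finite. The supremum is taken in $[0,+\infty]$, with $0\cdot\infty=0$. *)

theory Defs
  imports "HOL-Analysis.Analysis"
begin

definition R :: "(real \<Rightarrow> real) \<Rightarrow> real \<Rightarrow> real \<Rightarrow> real" where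
  "R r a x = (LINT t:{a<..<x}|lebesgue. r t)"

end

theory Submission
  imports Defs
begin

text \<open>By the Cauchy--Schwarz inequality with weights \<open>1 / s\<close> and \<open>s\<close>, the square of
  \<open>\<integral>\<^sub>x\<^sup>b f\<close> is at most \<open>\<integral>\<^sub>a\<^sup>b 1 / s\<close> times \<open>\<integral>\<^sub>a\<^sup>b s f\<^sup>2\<close>, uniformly in \<open>x\<close>.  Integrating
  this constant bound against \<open>r\<close> yields the factor \<open>\<integral>\<^sub>a\<^sup>b r\<close>, which by monotone
  convergence is the supremum of \<open>R r a x\<close>.\<close>

text \<open>Integrating the pointwise inequality
  \<open>(l - s x * f x)\<^sup>2 / s x \<ge> 0\<close> over \<open>A\<close> shows that a quadratic
  polynomial in \<open>l\<close> is nonnegative for every real \<open>l\<close>; the claim is its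
  discriminant condition.\<close>

lemma weighted_Cauchy_Schwarz_set_integral:
  fixes f s :: "'a \<Rightarrow> real"
  assumes f: "set_integrable M A f"
    and w: "set_integrable M A (\<lambda>x. 1 / s x)"
    and g: "set_integrable M A (\<lambda>x. s x * (f x)\<^sup>2)"
    and pos: "\<And>x. x \<in> A \<Longrightarrow> 0 < s x"
  shows "(LINT x:A|M. f x)\<^sup>2 \<le> (LINT x:A|M. 1 / s x) * (LINT x:A|M. s x * (f x)\<^sup>2)"
proof -
  define F P Q where "F = (LINT x:A|M. f x)" and "P = (LINT x:A|M. 1 / s x)"
    and "Q = (LINT x:A|M. s x * (f x)\<^sup>2)"
  have quadratic: "2 * l * F \<le> l\<^sup>2 * P + Q" for l
  proof -
    have "2 * l * f x \<le> l\<^sup>2 * (1 / s x) + s x * (f x)\<^sup>2" if "x \<in> A" for x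
    proof -
      have "l\<^sup>2 * (1 / s x) + s x * (f x)\<^sup>2 - 2 * l * f x = (l - s x * f x)\<^sup>2 / s x"
        using pos[OF that] by (simp add: field_simps power2_eq_square)
      also have "\<dots> \<ge> 0"
        using pos[OF that] by simp
      finally show ?thesis by simp
    qed
    then have "(LINT x:A|M. 2 * l * f x) \<le> (LINT x:A|M. l\<^sup>2 * (1 / s x) + s x * (f x)\<^sup>2)"
      using f w g by (intro set_integral_mono set_integral_add set_integrable_mult_right)
    also have "\<dots> = (LINT x:A|M. l\<^sup>2 * (1 / s x)) + Q"
      unfolding Q_def using w g by (intro set_integral_add set_integrable_mult_right)
    finally show ?thesis
      unfolding F_def P_def set_integral_mult_right .
  qed
  have "P \<ge> 0"
    unfolding P_def set_lebesgue_integral_def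
    by (intro Bochner_Integration.integral_nonneg)
       (use pos in \<open>auto simp: indicator_def intro: less_imp_le\<close>)
  have "F\<^sup>2 \<le> P * Q"
  \<comment> \<open>If \<open>P = 0\<close>, the quadratic bound degenerates to
    \<open>2 * l * F \<le> Q\<close> for all \<open>l\<close>, which forces \<open>F = 0\<close>:
    taking \<open>l = (Q + 1) / F\<close> would give \<open>2 * (Q + 1) \<le> Q\<close>, whereas
    \<open>l = 0\<close> gives \<open>0 \<le> Q\<close>.\<close>
  proof (cases "P = 0")
    case True
    have "F = 0"
    proof (rule ccontr)
      assume "F \<noteq> 0"
      with quadratic[of "(Q + 1) / F"] quadratic[of 0] True show False
        by simp
    qed
    then show ?thesis using True by simp
  next
    case False
    then have "P > 0" using \<open>P \<ge> 0\<close> by simp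
    \<comment> \<open>The choice \<open>l = F / P\<close> minimises
      \<open>l\<^sup>2 * P - 2 * l * F + Q\<close>.\<close>
    then show ?thesis
      using quadratic[of "F / P"] by (simp add: field_simps power2_eq_square)
  qed
  then show ?thesis
    unfolding F_def P_def Q_def .
qed

text \<open>A sequence of right endpoints increasing to \<open>b\<close> exhausts the interval, and
  the measure with density \<open>h\<close> is continuous from below. Values in
  \<open>ennreal\<close> allow the integral up to \<open>b\<close> to be infinite.\<close>

lemma nn_integral_le_SUP_left_subintervals:
  fixes h :: "real \<Rightarrow> ennreal"
  assumes ab: "a < b" and h[measurable]: "h \<in> borel_measurable lebesgue"
  shows "(\<integral>\<^sup>+x\<in>{a<..<b}. h x \<partial>lebesgue) \<le> (SUP c\<in>{a<..<b}. \<integral>\<^sup>+x\<in>{a<..<c}. h x \<partial>lebesgue)"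
proof -
  \<comment> \<open>The shift by 2 makes \<open>c 0\<close> the midpoint; a shift by 1 would give
    \<open>c 0 = a\<close>, outside the open interval.\<close>
  define c where "c n = b - (b - a) / real (n + 2)" for n
  have c: "c n \<in> {a<..<b}" for n
    using ab
    by (auto simp: c_def field_simps intro!: add_less_le_mono mult_right_mono)
  have "incseq c"
    using ab by (auto simp: c_def incseq_def intro!: divide_left_mono)
  then have inc: "incseq (\<lambda>n. {a<..<c n})"
    by (auto simp: incseq_def) (meson less_le_trans)
  have "c \<longlonglongrightarrow> b - 0"
    unfolding c_def
    by (intro tendsto_diff tendsto_const LIMSEQ_ignore_initial_segment[OF lim_const_over_n])
  then have "c \<longlonglongrightarrow> b" by simp
  have "\<exists>n. x < c n" if "x < b" for x
    using order_tendstoD(1)[OF \<open>c \<longlonglongrightarrow> b\<close> that] by (auto simp: eventually_sequentially)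
  then have un: "(\<Union>n. {a<..<c n}) = {a<..<b}"
    using c by auto (metis less_trans)
  have "(\<integral>\<^sup>+x\<in>{a<..<b}. h x \<partial>lebesgue) = emeasure (density lebesgue h) (\<Union>n. {a<..<c n})"
    by (simp add: un emeasure_density)
  also have "\<dots> = (SUP n. emeasure (density lebesgue h) {a<..<c n})"
    using inc by (intro SUP_emeasure_incseq[symmetric]) auto
  also have "\<dots> = (SUP n. \<integral>\<^sup>+x\<in>{a<..<c n}. h x \<partial>lebesgue)"
    by (simp add: emeasure_density)
  also have "\<dots> \<le> (SUP c\<in>{a<..<b}. \<integral>\<^sup>+x\<in>{a<..<c}. h x \<partial>lebesgue)"
    using c by (intro SUP_mono) auto
  finally show ?thesis .
qed

theorem theorem2p6:
  fixes a b :: real and r s f :: "real \<Rightarrow> real"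
  assumes "a < b"
    and "continuous_on {a<..<b} r" and "\<forall>x\<in>{a<..<b}. 0 < r x"
    and "continuous_on {a<..<b} s" and "\<forall>x\<in>{a<..<b}. 0 < s x"
    and "f \<in> borel_measurable (lebesgue_on {a<..<b})" and "\<forall>x\<in>{a<..<b}. 0 \<le> f x"
    and "\<forall>x\<in>{a<..<b}. set_integrable lebesgue {a<..<x} r"
    and "\<forall>x\<in>{a<..<b}. set_integrable lebesgue {x<..<b} f"
    and "set_integrable lebesgue {a<..<b} (\<lambda>x. r x * (LINT t:{x<..<b}|lebesgue. f t)\<^sup>2)"
    and "set_integrable lebesgue {a<..<b} (\<lambda>x. 1 / s x)"
    and "set_integrable lebesgue {a<..<b} (\<lambda>x. s x * (f x)\<^sup>2)"
  shows "ennreal (LINT x:{a<..<b}|lebesgue. r x * (LINT t:{x<..<b}|lebesgue. f t)\<^sup>2)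
    \<le> (SUP x\<in>{a<..<b}. ennreal (R r a x))
        * ennreal (LINT x:{a<..<b}|lebesgue. 1 / s x)
        * ennreal (LINT x:{a<..<b}|lebesgue. s x * (f x)\<^sup>2)"
proof -
  let ?I = "{a<..<b}"
  let ?F = "\<lambda>x. LINT t:{x<..<b}|lebesgue. f t"
  define P Q where "P = (LINT x:?I|lebesgue. 1 / s x)"
    and "Q = (LINT x:?I|lebesgue. s x * (f x)\<^sup>2)"
  have rpos: "0 \<le> r x" and spos: "0 < s x" if "x \<in> ?I" for x
    using assms(3,5) that by (auto intro: less_imp_le)
  have PQ: "0 \<le> P" "0 \<le> Q"
    unfolding P_def Q_def set_lebesgue_integral_def
    by (intro Bochner_Integration.integral_nonneg;
        use spos in \<open>auto simp: indicator_def less_imp_le\<close>)+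
  have F: "(?F x)\<^sup>2 \<le> P * Q" if x: "x \<in> ?I" for x
  proof -
    have sub: "{x<..<b} \<subseteq> ?I"
      using x by auto
    have w: "set_integrable lebesgue {x<..<b} (\<lambda>x. 1 / s x)"
      and g: "set_integrable lebesgue {x<..<b} (\<lambda>x. s x * (f x)\<^sup>2)"
      using assms(11,12) sub by (auto intro: set_integrable_subset)
    have "(?F x)\<^sup>2 \<le> (LINT t:{x<..<b}|lebesgue. 1 / s t) * (LINT t:{x<..<b}|lebesgue. s t * (f t)\<^sup>2)"
      using assms(9) x w g sub spos by (intro weighted_Cauchy_Schwarz_set_integral) auto
    \<comment> \<open>Both integrands are nonnegative, so enlarging the domain to \<open>?I\<close>
      removes the dependence on \<open>x\<close>.\<close>
    also have "\<dots> \<le> P * Q"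
      unfolding P_def Q_def set_lebesgue_integral_def
      using w g assms(11,12) sub spos
      by (intro mult_mono integral_mono Bochner_Integration.integral_nonneg)
         (auto simp: set_integrable_def indicator_def less_imp_le)
    finally show ?thesis .
  qed
  \<comment> \<open>Nothing is known about \<open>r\<close> outside \<open>?I\<close>, so its
    extension by zero serves as the density \<open>h\<close> on the whole line.\<close>
  have "(\<lambda>x. indicator ?I x *\<^sub>R r x) \<in> borel_measurable borel"
    using assms(2) by (intro borel_measurable_continuous_on_indicator) auto
  then have "(\<lambda>x. indicator ?I x *\<^sub>R r x) \<in> borel_measurable lebesgue"
    by (intro measurable_completion) simp
  then have meas: "(\<lambda>x. ennreal (indicator ?I x * r x)) \<in> borel_measurable lebesgue"
    by simp
  have R: "(\<integral>\<^sup>+t\<in>{a<..<x}. ennreal (indicator ?I t * r t) \<partial>lebesgue) = ennreal (R r a x)"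
    if x: "x \<in> ?I" for x
  proof -
    have "(\<integral>\<^sup>+t\<in>{a<..<x}. ennreal (indicator ?I t * r t) \<partial>lebesgue)
        = (\<integral>\<^sup>+t. ennreal (indicator {a<..<x} t *\<^sub>R r t) \<partial>lebesgue)"
      using x by (intro nn_integral_cong) (auto simp: indicator_def)
    also have "\<dots> = ennreal (R r a x)"
      unfolding R_def set_lebesgue_integral_def
      using assms(8) x rpos
      by (intro nn_integral_eq_integral) (auto simp: set_integrable_def indicator_def)
    finally show ?thesis .
  qed
  \<comment> \<open>From here on the integrals are nonnegative ones: \<open>r\<close> may fail to be
    integrable up to \<open>b\<close>, and its Bochner integral over \<open>?I\<close> would then be
    0 by default.\<close>
  have "ennreal (LINT x:?I|lebesgue. r x * (?F x)\<^sup>2)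
      = (\<integral>\<^sup>+x. ennreal (indicator ?I x *\<^sub>R (r x * (?F x)\<^sup>2)) \<partial>lebesgue)"
    unfolding set_lebesgue_integral_def
    using assms(10) rpos
    by (intro nn_integral_eq_integral[symmetric])
       (auto simp: set_integrable_def set_lebesgue_integral_def indicator_def)
  also have "\<dots> \<le> (\<integral>\<^sup>+x. ennreal (indicator ?I x * r x) * indicator ?I x * ennreal (P * Q) \<partial>lebesgue)"
    using F rpos PQ
    by (intro nn_integral_mono)
       (auto simp: indicator_def ennreal_mult[symmetric] intro!: ennreal_leI mult_left_mono)
  \<comment> \<open>The constant factors out even if the integral of \<open>r\<close> is infinite
    and \<open>P * Q = 0\<close>, since \<infinity> times 0 is 0 in \<open>ennreal\<close>.\<close>
  also have "\<dots> = (\<integral>\<^sup>+x\<in>?I. ennreal (indicator ?I x * r x) \<partial>lebesgue) * ennreal (P * Q)"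
    by (intro nn_integral_multc borel_measurable_times_ennreal meas borel_measurable_indicator) simp
  also have "\<dots> \<le> (SUP x\<in>?I. \<integral>\<^sup>+t\<in>{a<..<x}. ennreal (indicator ?I t * r t) \<partial>lebesgue) * ennreal (P * Q)"
    using assms(1) meas by (intro mult_right_mono nn_integral_le_SUP_left_subintervals) auto
  also have "\<dots> = (SUP x\<in>?I. ennreal (R r a x)) * ennreal P * ennreal Q"
    using PQ by (simp only: SUP_cong[OF refl R] ennreal_mult mult.assoc)
  finally show ?thesis
    unfolding P_def Q_def .
qed

end
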